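(* Let $A\in\mathbb{R}^{d\times n}$ satisfy $rk_t(A)=r$ and $rk_K(A)>r$. Then there exist $A'\in\mathbb{R}^{(d+1)\times n}$ and $A''\in\mathbb{R}^{d\times(n+1)}$ such that $rk_t(A')=rk_t(A'')=r$ and $rk_K(A')=rk_K(A'')>r$.
   Context: Tropical rank $rk_t$: largest $r$ such that the matrix has an $r\times r$ submatrix $S$ for which $\min_{\sigma}\sum_i s_{i\sigma(i)}$ is attained by exactly one permutation. Kapranov rank $rk_K(B)$: minimal rank over $\mathbf K$ of a matrix $A\in\mathbf K^{m\times n}$ with $\deg a_{ij}=b_{ij}$, where $\mathbf K$ is the field of formal sums $\sum_{e\in\mathbb{R}}a_et^e$ ($a_e\in\mathbb{C}$) with well-ordered support and $\deg$ is the minimal exponent ($\deg 0=\infty$). *)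

theory Defs
  imports
    Complex_Main
    "HOL-Library.Extended_Real"
    "Jordan_Normal_Form.DL_Rank"
    "Jordan_Normal_Form.DL_Submatrix"
begin

definition well_ordered_set :: "real set \<Rightarrow> bool" where
  "well_ordered_set S \<longleftrightarrow> (\<forall>T. T \<subseteq> S \<and> T \<noteq> {} \<longrightarrow> (\<exists>m\<in>T. \<forall>x\<in>T. m \<le> x))"

lemma well_ordered_setI:
  "(\<And>T. T \<subseteq> S \<Longrightarrow> T \<noteq> {} \<Longrightarrow> \<exists>m\<in>T. \<forall>x\<in>T. m \<le> x) \<Longrightarrow> well_ordered_set S"
  by (simp add: well_ordered_set_def)

lemma well_ordered_set_ex_min:
  "well_ordered_set S \<Longrightarrow> T \<subseteq> S \<Longrightarrow> T \<noteq> {} \<Longrightarrow> \<exists>m\<in>T. \<forall>x\<in>T. m \<le> x"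
  by (simp add: well_ordered_set_def)

lemma well_ordered_setD:
  assumes "well_ordered_set S" "T \<subseteq> S" "T \<noteq> {}"
  obtains m where "m \<in> T" "\<And>x. x \<in> T \<Longrightarrow> m \<le> x"
proof -
  obtain m where "m \<in> T" "\<forall>x\<in>T. m \<le> x" using well_ordered_set_ex_min[OF assms] by (rule bexE)
  then show ?thesis by (intro that[of m]) simp_all
qed

lemma well_ordered_set_subset: "well_ordered_set S \<Longrightarrow> T \<subseteq> S \<Longrightarrow> well_ordered_set T"
  by (rule well_ordered_setI, erule well_ordered_set_ex_min) (erule (1) order_trans)

lemma well_ordered_set_empty: "well_ordered_set {}"
  by (rule well_ordered_setI) simp

lemma well_ordered_set_singleton: "well_ordered_set {x}"
  by (rule well_ordered_setI) (simp add: subset_singleton_iff)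

lemma well_ordered_set_Un:
  assumes S: "well_ordered_set S" and T: "well_ordered_set T"
  shows "well_ordered_set (S \<union> T)"
proof (rule well_ordered_setI)
  fix Z assume Z: "Z \<subseteq> S \<union> T" "Z \<noteq> {}"
  show "\<exists>m\<in>Z. \<forall>x\<in>Z. m \<le> x"
  proof (cases "Z \<inter> S = {} \<or> Z \<inter> T = {}")
    case True
    then have "Z \<subseteq> S \<or> Z \<subseteq> T" using Z by blast
    then show ?thesis using well_ordered_set_ex_min[OF S _ Z(2)] well_ordered_set_ex_min[OF T _ Z(2)] by (elim disjE)
  next
    case False
    obtain s where s: "s \<in> Z \<inter> S" "\<And>x. x \<in> Z \<inter> S \<Longrightarrow> s \<le> x"
      using well_ordered_setD[OF S, of "Z \<inter> S"] False by blast
    obtain t where t: "t \<in> Z \<inter> T" "\<And>x. x \<in> Z \<inter> T \<Longrightarrow> t \<le> x"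
      using well_ordered_setD[OF T, of "Z \<inter> T"] False by blast
    have "min s t \<in> Z" using s(1) t(1) by (auto simp: min_def)
    moreover have "\<forall>x\<in>Z. min s t \<le> x" using s(2) t(2) Z(1) by (metis Int_iff Un_iff min.coboundedI1 min.coboundedI2 subsetD)
    ultimately show ?thesis by blast
  qed
qed

lemma well_ordered_set_UN_finite:
  "finite I \<Longrightarrow> (\<And>i. i \<in> I \<Longrightarrow> well_ordered_set (S i)) \<Longrightarrow> well_ordered_set (\<Union>i\<in>I. S i)"
  by (induction I rule: finite_induct) (auto simp: well_ordered_set_empty intro: well_ordered_set_Un)

lemma well_ordered_set_sumset:
  assumes S: "well_ordered_set S" and T: "well_ordered_set T"
  shows "well_ordered_set {x + y | x y. x \<in> S \<and> y \<in> T}"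
proof (rule well_ordered_setI)
  fix Z assume Z: "Z \<subseteq> {x + y | x y. x \<in> S \<and> y \<in> T}" "Z \<noteq> {}"
  show "\<exists>m\<in>Z. \<forall>x\<in>Z. m \<le> x"
  proof (rule ccontr)
    assume "\<not> ?thesis"
    then have desc: "\<And>z. z \<in> Z \<Longrightarrow> \<exists>z'. z' \<in> Z \<and> z' < z" by (meson not_le)
    obtain z0 where "z0 \<in> Z" using Z(2) by blast
    then obtain z where z: "\<And>n::nat. z n \<in> Z \<and> z (Suc n) < z n"
      using dependent_nat_choice[of "\<lambda>_ x. x \<in> Z" "\<lambda>_ x y. y < x"] desc by metis
    have "\<forall>n. \<exists>p. fst p \<in> S \<and> snd p \<in> T \<and> z n = fst p + snd p"
    proof
      fix n
      obtain u v where "u \<in> S" "v \<in> T" "z n = u + v" using z Z(1) by blast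
      then show "\<exists>p. fst p \<in> S \<and> snd p \<in> T \<and> z n = fst p + snd p"
        by (intro exI[of _ "(u, v)"]) simp
    qed
    then obtain p where p: "\<And>n. fst (p n) \<in> S" "\<And>n. snd (p n) \<in> T" "\<And>n. z n = fst (p n) + snd (p n)"
      by metis
    define x where "x = (\<lambda>n. fst (p n))"
    define y where "y = (\<lambda>n. snd (p n))"
    obtain f where f: "strict_mono f" "monoseq (\<lambda>n. x (f n))" using seq_monosub by blast
    have zanti: "z j < z i" if "i < j" for i j
      using that z by (metis strict_mono_def lift_Suc_antimono_le lift_Suc_mono_less_iff less_irrefl neg_less_iff_less lift_Suc_mono_less[of "\<lambda>n. - z n"])
    have "\<exists>k. \<forall>n\<ge>k. x (f k) \<le> x (f n)"
    proof -
      obtain m where "m \<in> range (\<lambda>n. x (f n))" "\<And>v. v \<in> range (\<lambda>n. x (f n)) \<Longrightarrow> m \<le> v"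
        using well_ordered_setD[OF S, of "range (\<lambda>n. x (f n))"] p(1) unfolding x_def by blast
      then show ?thesis by blast
    qed
    have "\<exists>k. \<forall>i\<ge>k. \<forall>j\<ge>i. x (f i) \<le> x (f j)"
    proof (cases "\<forall>i. \<forall>j\<ge>i. x (f i) \<le> x (f j)")
      case False
      then have d: "\<And>i j. i \<le> j \<Longrightarrow> x (f j) \<le> x (f i)" using f(2) unfolding monoseq_def by blast
      obtain k where k: "\<forall>n\<ge>k. x (f k) \<le> x (f n)" using \<open>\<exists>k. \<forall>n\<ge>k. x (f k) \<le> x (f n)\<close> by blast
      show ?thesis by (intro exI[of _ k] allI impI) (meson d k order_trans)
    qed auto
    then obtain k where k: "\<And>i j. k \<le> i \<Longrightarrow> i \<le> j \<Longrightarrow> x (f i) \<le> x (f j)" by blast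
    have yd: "y (f (Suc i)) < y (f i)" if "k \<le> i" for i
    proof -
      have "z (f (Suc i)) < z (f i)" by (rule zanti) (use f(1) in \<open>simp add: strict_mono_def\<close>)
      moreover have "x (f i) \<le> x (f (Suc i))" using k that by simp
      ultimately show ?thesis using p(3) unfolding x_def y_def by (smt (verit))
    qed
    obtain m where m: "m \<in> (\<lambda>i. y (f i)) ` {k..}" "\<And>v. v \<in> (\<lambda>i. y (f i)) ` {k..} \<Longrightarrow> m \<le> v"
      using well_ordered_setD[OF T, of "(\<lambda>i. y (f i)) ` {k..}"] p(2) unfolding y_def by blast
    then obtain i where i: "k \<le> i" "m = y (f i)" by auto
    have "m \<le> y (f (Suc i))" using m(2) i(1) by simp
    then show False using yd[OF i(1)] i(2) by simp
  qed
qed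

lemma well_ordered_set_finite_fibre:
  assumes S: "well_ordered_set S" and T: "well_ordered_set T"
  shows "finite {x. x \<in> S \<and> e - x \<in> T}" (is "finite ?X")
proof (rule ccontr)
  assume inf: "infinite ?X"
  have XS: "well_ordered_set ?X" by (rule well_ordered_set_subset[OF S]) blast
  have hasmax: "\<exists>m\<in>U. \<forall>x\<in>U. x \<le> m" if U: "U \<subseteq> ?X" "U \<noteq> {}" for U
  proof -
    obtain m where m: "m \<in> (\<lambda>x. e - x) ` U" "\<And>v. v \<in> (\<lambda>x. e - x) ` U \<Longrightarrow> m \<le> v"
      using well_ordered_setD[OF T, of "(\<lambda>x. e - x) ` U"] U by blast
    then obtain u where u: "u \<in> U" "m = e - u" by blast
    show ?thesis by (rule bexI[OF _ u(1)]) (use m(2) u(2) in fastforce)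
  qed
  define U where "U = {x\<in>?X. finite {y\<in>?X. y \<le> x}}"
  have UX: "U \<subseteq> ?X" unfolding U_def by blast
  show False
  proof (cases "U = ?X")
    case True
    have "?X \<noteq> {}" using inf by (metis finite.emptyI)
    then obtain m where m: "m \<in> ?X" "\<forall>x\<in>?X. x \<le> m" using hasmax[of ?X] by blast
    then have "finite {y\<in>?X. y \<le> m}" using True unfolding U_def by blast
    moreover have "{y\<in>?X. y \<le> m} = ?X" using m(2) by blast
    ultimately show False using inf by simp
  next
    case False
    then have "?X - U \<noteq> {}" using UX by blast
    then obtain m where m: "m \<in> ?X - U" "\<And>v. v \<in> ?X - U \<Longrightarrow> m \<le> v"
      using well_ordered_setD[OF XS, of "?X - U"] by blast
    have below: "{y\<in>?X. y \<le> m} \<subseteq> insert m U"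
    proof
      fix y assume y: "y \<in> {y\<in>?X. y \<le> m}"
      show "y \<in> insert m U"
      proof (rule ccontr)
        assume "y \<notin> insert m U"
        then have "y \<noteq> m" "y \<in> ?X - U" using y by auto
        then show False using m(2) y by force
      qed
    qed
    have "finite U"
    proof (cases "U = {}")
      case False
      then obtain u where u: "u \<in> U" "\<forall>x\<in>U. x \<le> u" using hasmax[OF UX] by blast
      have "finite {y\<in>?X. y \<le> u}" using u(1) unfolding U_def by blast
      moreover have "U \<subseteq> {y\<in>?X. y \<le> u}" using u(2) UX by blast
      ultimately show ?thesis by (rule rev_finite_subset)
    qed simp
    then have "finite {y\<in>?X. y \<le> m}" using below by (meson finite_insert finite_subset)
    then have "m \<in> U" unfolding U_def using m(1) by blast
    then show False using m(1) by blast
  qed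
qed

text \<open>An element of \<open>hahn\<close> is the formal sum of \<open>a e * t ^ e\<close> over real exponents \<open>e\<close>,
  represented by its coefficient function \<open>a\<close>.\<close>

typedef hahn = "{a :: real \<Rightarrow> complex. well_ordered_set {e. a e \<noteq> 0}}"
  morphisms hcoeff Abs_hahn
  by (rule exI[of _ "\<lambda>_. 0"]) (simp add: well_ordered_set_empty)

setup_lifting type_definition_hahn

definition hsupp :: "hahn \<Rightarrow> real set" where
  "hsupp a = {e. hcoeff a e \<noteq> 0}"

lemma well_ordered_hsupp: "well_ordered_set (hsupp a)"
  using hcoeff[of a] by (simp add: hsupp_def)

lemma hahn_eqI: "(\<And>e. hcoeff a e = hcoeff b e) \<Longrightarrow> a = b"
  by (simp add: hcoeff_inject[symmetric] fun_eq_iff)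

lift_definition hmonom :: "complex \<Rightarrow> real \<Rightarrow> hahn" is
  "\<lambda>c g e. if e = g then c else 0"
  by (rule well_ordered_set_subset[OF well_ordered_set_singleton]) (auto split: if_splits)

text \<open>The sum defining a coefficient of a product is finite by
  \<open>well_ordered_set_finite_fibre\<close>, so it is a genuine convolution.\<close>

instantiation hahn :: comm_ring_1
begin

lift_definition zero_hahn :: hahn is "\<lambda>_. 0"
  by (simp add: well_ordered_set_empty)

definition one_hahn :: hahn where "1 = hmonom 1 0"

lift_definition plus_hahn :: "hahn \<Rightarrow> hahn \<Rightarrow> hahn" is "\<lambda>a b e. a e + b e"
  subgoal premises prems
    by (rule well_ordered_set_subset[OF well_ordered_set_Un[OF prems]]) auto
  done

lift_definition uminus_hahn :: "hahn \<Rightarrow> hahn" is "\<lambda>a e. - a e"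
  by simp

lift_definition minus_hahn :: "hahn \<Rightarrow> hahn \<Rightarrow> hahn" is "\<lambda>a b e. a e - b e"
  subgoal premises prems
    by (rule well_ordered_set_subset[OF well_ordered_set_Un[OF prems]]) auto
  done

lift_definition times_hahn :: "hahn \<Rightarrow> hahn \<Rightarrow> hahn" is
  "\<lambda>a b e. \<Sum>x \<in> {x. a x \<noteq> 0 \<and> b (e - x) \<noteq> 0}. a x * b (e - x)"
proof -
  fix a b :: "real \<Rightarrow> complex"
  assume a: "well_ordered_set {e. a e \<noteq> 0}" and b: "well_ordered_set {e. b e \<noteq> 0}"
  show "well_ordered_set {e. (\<Sum>x \<in> {x. a x \<noteq> 0 \<and> b (e - x) \<noteq> 0}. a x * b (e - x)) \<noteq> 0}"
  proof (rule well_ordered_set_subset[OF well_ordered_set_sumset[OF a b]], rule subsetI)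
    fix e assume "e \<in> {e. (\<Sum>x \<in> {x. a x \<noteq> 0 \<and> b (e - x) \<noteq> 0}. a x * b (e - x)) \<noteq> 0}"
    then have "{x. a x \<noteq> 0 \<and> b (e - x) \<noteq> 0} \<noteq> {}" by (metis (mono_tags, lifting) mem_Collect_eq sum.empty)
    then obtain x where "a x \<noteq> 0" "b (e - x) \<noteq> 0" by blast
    then show "e \<in> {x + y | x y. x \<in> {e. a e \<noteq> 0} \<and> y \<in> {e. b e \<noteq> 0}}"
      by (intro CollectI exI[of _ x] exI[of _ "e - x"]) simp
  qed
qed

lemma finite_hahn_fibre: "finite {x. hcoeff a x \<noteq> 0 \<and> hcoeff b (e - x) \<noteq> 0}"
  using well_ordered_set_finite_fibre[OF well_ordered_hsupp[of a] well_ordered_hsupp[of b], of e]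
  by (simp add: hsupp_def)

lemma hcoeff_times:
  assumes "finite F" "{x. hcoeff a x \<noteq> 0 \<and> hcoeff b (e - x) \<noteq> 0} \<subseteq> F"
  shows "hcoeff (a * b) e = (\<Sum>x\<in>F. hcoeff a x * hcoeff b (e - x))"
  unfolding times_hahn.rep_eq by (rule sum.mono_neutral_left) (use assms in auto)

lemma hsupp_times: "hsupp (a * b) \<subseteq> {x + y | x y. x \<in> hsupp a \<and> y \<in> hsupp b}"
proof
  fix e assume "e \<in> hsupp (a * b)"
  then have "{x. hcoeff a x \<noteq> 0 \<and> hcoeff b (e - x) \<noteq> 0} \<noteq> {}"
    unfolding hsupp_def times_hahn.rep_eq by (metis (mono_tags, lifting) mem_Collect_eq sum.empty)
  then obtain x where "hcoeff a x \<noteq> 0" "hcoeff b (e - x) \<noteq> 0" by blast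
  then show "e \<in> {x + y | x y. x \<in> hsupp a \<and> y \<in> hsupp b}"
    by (intro CollectI exI[of _ x] exI[of _ "e - x"]) (simp add: hsupp_def)
qed

lemma times_hahn_commute: "a * b = b * (a :: hahn)"
proof (rule hahn_eqI)
  fix e
  show "hcoeff (a * b) e = hcoeff (b * a) e"
    unfolding times_hahn.rep_eq
    by (rule sum.reindex_bij_witness[of _ "\<lambda>x. e - x" "\<lambda>x. e - x"]) auto
qed

lemma times_hahn_assoc: "(a * b) * c = a * (b * (c :: hahn))"
proof (rule hahn_eqI)
  fix e
  let ?A = "hsupp a" and ?B = "hsupp b" and ?C = "hsupp c"
  define W where "W = {w. w \<in> {x + y | x y. x \<in> ?A \<and> y \<in> ?B} \<and> e - w \<in> ?C}"
  define X where "X = {x. x \<in> ?A \<and> e - x \<in> {x + y | x y. x \<in> ?B \<and> y \<in> ?C}}"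
  have fW: "finite W" unfolding W_def
    by (intro well_ordered_set_finite_fibre well_ordered_set_sumset well_ordered_hsupp)
  have fX: "finite X" unfolding X_def
    by (intro well_ordered_set_finite_fibre well_ordered_set_sumset well_ordered_hsupp)
  have "hcoeff ((a * b) * c) e = (\<Sum>w\<in>W. hcoeff (a * b) w * hcoeff c (e - w))"
    by (rule hcoeff_times[OF fW]) (use hsupp_times[of a b] in \<open>auto simp: W_def hsupp_def\<close>)
  also have "\<dots> = (\<Sum>w\<in>W. \<Sum>x\<in>X. hcoeff a x * hcoeff b (w - x) * hcoeff c (e - w))"
  proof (rule sum.cong[OF refl])
    fix w assume w: "w \<in> W"
    have "hcoeff (a * b) w = (\<Sum>x\<in>X. hcoeff a x * hcoeff b (w - x))"
    proof (rule hcoeff_times[OF fX], rule subsetI)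
      fix x assume "x \<in> {x. hcoeff a x \<noteq> 0 \<and> hcoeff b (w - x) \<noteq> 0}"
      then have "x \<in> ?A" "w - x \<in> ?B" by (auto simp: hsupp_def)
      moreover have "e - w \<in> ?C" using w by (simp add: W_def)
      moreover have "e - x = (w - x) + (e - w)" by simp
      ultimately show "x \<in> X" unfolding X_def by blast
    qed
    then show "hcoeff (a * b) w * hcoeff c (e - w) = (\<Sum>x\<in>X. hcoeff a x * hcoeff b (w - x) * hcoeff c (e - w))"
      by (simp add: sum_distrib_right)
  qed
  also have "\<dots> = (\<Sum>x\<in>X. \<Sum>w\<in>W. hcoeff a x * hcoeff b (w - x) * hcoeff c (e - w))"
    by (rule sum.swap)
  also have "\<dots> = (\<Sum>x\<in>X. hcoeff a x * hcoeff (b * c) (e - x))"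
  proof (rule sum.cong[OF refl])
    fix x assume x: "x \<in> X"
    have "hcoeff (b * c) (e - x) = (\<Sum>y\<in>(\<lambda>w. w - x) ` W. hcoeff b y * hcoeff c (e - x - y))"
    proof (rule hcoeff_times, rule finite_imageI[OF fW], rule subsetI)
      fix y assume "y \<in> {y. hcoeff b y \<noteq> 0 \<and> hcoeff c (e - x - y) \<noteq> 0}"
      then have "y \<in> ?B" "e - (x + y) \<in> ?C" by (auto simp: hsupp_def algebra_simps)
      moreover have "x \<in> ?A" using x by (simp add: X_def)
      ultimately have "x + y \<in> W" unfolding W_def by blast
      then show "y \<in> (\<lambda>w. w - x) ` W" by (rule rev_image_eqI) simp
    qed
    also have "\<dots> = (\<Sum>w\<in>W. hcoeff b (w - x) * hcoeff c (e - w))"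
      by (subst sum.reindex) (auto simp: inj_on_def)
    finally show "(\<Sum>w\<in>W. hcoeff a x * hcoeff b (w - x) * hcoeff c (e - w)) = hcoeff a x * hcoeff (b * c) (e - x)"
      by (simp add: sum_distrib_left mult.assoc)
  qed
  also have "\<dots> = hcoeff (a * (b * c)) e"
    by (rule hcoeff_times[OF fX, symmetric]) (use hsupp_times[of b c] in \<open>auto simp: X_def hsupp_def\<close>)
  finally show "hcoeff ((a * b) * c) e = hcoeff (a * (b * c)) e" .
qed

lemma hcoeff_hmonom_times: "hcoeff (hmonom c g * a) e = c * hcoeff a (e - g)"
proof -
  have "hcoeff (hmonom c g * a) e = (\<Sum>x\<in>{g}. hcoeff (hmonom c g) x * hcoeff a (e - x))"
    by (rule hcoeff_times) (auto simp: hmonom.rep_eq split: if_splits)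
  then show ?thesis by (simp add: hmonom.rep_eq)
qed

lemma times_hahn_distrib: "(a + b) * c = a * c + b * (c :: hahn)"
proof (rule hahn_eqI)
  fix e
  define F where "F = {x. hcoeff a x \<noteq> 0 \<and> hcoeff c (e - x) \<noteq> 0} \<union> {x. hcoeff b x \<noteq> 0 \<and> hcoeff c (e - x) \<noteq> 0}"
  have F: "finite F" unfolding F_def using finite_hahn_fibre by simp
  have 1: "hcoeff ((a + b) * c) e = (\<Sum>x\<in>F. hcoeff (a + b) x * hcoeff c (e - x))"
    by (rule hcoeff_times[OF F]) (auto simp: F_def plus_hahn.rep_eq)
  have 2: "hcoeff (a * c) e = (\<Sum>x\<in>F. hcoeff a x * hcoeff c (e - x))"
    by (rule hcoeff_times[OF F]) (auto simp: F_def)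
  have 3: "hcoeff (b * c) e = (\<Sum>x\<in>F. hcoeff b x * hcoeff c (e - x))"
    by (rule hcoeff_times[OF F]) (auto simp: F_def)
  show "hcoeff ((a + b) * c) e = hcoeff (a * c + b * c) e"
    by (simp add: 1 2 3 plus_hahn.rep_eq sum.distrib distrib_right)
qed

instance
proof
  fix a b c :: hahn
  show "(0::hahn) \<noteq> 1"
  proof
    assume "(0::hahn) = 1"
    then have "hcoeff 0 0 = hcoeff 1 0" by simp
    then show False by (simp add: zero_hahn.rep_eq one_hahn_def hmonom.rep_eq)
  qed
  show "1 * a = a"
    by (rule hahn_eqI) (simp add: one_hahn_def hcoeff_hmonom_times)
  show "a * b * c = a * (b * c)" by (rule times_hahn_assoc)
  show "a * b = b * a" by (rule times_hahn_commute)
  show "(a + b) * c = a * c + b * c" by (rule times_hahn_distrib)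
qed (auto intro!: hahn_eqI simp: plus_hahn.rep_eq minus_hahn.rep_eq uminus_hahn.rep_eq zero_hahn.rep_eq)

end

lemma hmonom_times: "hmonom c g * hmonom d h = hmonom (c * d) (g + h)"
  by (rule hahn_eqI) (auto simp: hcoeff_hmonom_times hmonom.rep_eq)

lemma hsupp_power_ge:
  assumes "\<And>e. e \<in> hsupp u \<Longrightarrow> m \<le> e"
  shows "e \<in> hsupp (u ^ n) \<Longrightarrow> of_nat n * m \<le> e"
proof (induction n arbitrary: e)
  case 0
  then show ?case by (simp add: hsupp_def one_hahn_def hmonom.rep_eq split: if_splits)
next
  case (Suc n)
  then obtain x y where "x \<in> hsupp u" "y \<in> hsupp (u ^ n)" "e = x + y"
    using hsupp_times[of u "u ^ n"] by auto
  then show ?case using Suc.IH[of y] assms[of x] by (simp add: algebra_simps)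
qed

lemma hcoeff_sum: "hcoeff (sum f A) e = (\<Sum>i\<in>A. hcoeff (f i) e)"
  by (induction A rule: infinite_finite_induct) (auto simp: zero_hahn.rep_eq plus_hahn.rep_eq)

lemma ex_inverse_one_minus:
  fixes u :: hahn
  assumes m: "m > 0" and um: "\<And>e. e \<in> hsupp u \<Longrightarrow> m \<le> e"
  shows "\<exists>b. (1 - u) * b = 1"
proof -
  define N where "N = (\<lambda>e::real. nat \<lceil>e / m\<rceil>)"
  have van: "hcoeff (u ^ n) e = 0" if "n > N e" for n e
  proof (rule ccontr)
    assume "hcoeff (u ^ n) e \<noteq> 0"
    then have "of_nat n * m \<le> e" using hsupp_power_ge[OF um] by (simp add: hsupp_def)
    then have "of_nat n \<le> e / m" using m by (simp add: field_simps)
    then have "n \<le> N e" unfolding N_def by linarith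
    then show False using that by simp
  qed
  define B where "B = (\<lambda>e. \<Sum>n\<le>N e. hcoeff (u ^ n) e)"
  have Beq: "B e = hcoeff (\<Sum>n\<le>k. u ^ n) e" if "N e \<le> k" for e k
    unfolding B_def hcoeff_sum
    by (rule sum.mono_neutral_left) (use that van in auto)
  have Nmono: "N e \<le> N e'" if "e \<le> e'" for e e'
    unfolding N_def using that m by (intro nat_mono ceiling_mono divide_right_mono) auto
  have wB: "well_ordered_set {e. B e \<noteq> 0}"
  proof (rule well_ordered_setI)
    fix Z assume Z: "Z \<subseteq> {e. B e \<noteq> 0}" "Z \<noteq> {}"
    then obtain z where z: "z \<in> Z" by blast
    have sub: "{e\<in>Z. e \<le> z} \<subseteq> hsupp (\<Sum>n\<le>N z. u ^ n)"
    proof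
      fix e assume e: "e \<in> {e\<in>Z. e \<le> z}"
      then have "B e \<noteq> 0" using Z(1) by blast
      moreover have "B e = hcoeff (\<Sum>n\<le>N z. u ^ n) e" by (rule Beq, rule Nmono) (use e in simp)
      ultimately show "e \<in> hsupp (\<Sum>n\<le>N z. u ^ n)" by (simp add: hsupp_def)
    qed
    have ne: "{e\<in>Z. e \<le> z} \<noteq> {}" using z by blast
    obtain l where l: "l \<in> {e\<in>Z. e \<le> z}" "\<And>x. x \<in> {e\<in>Z. e \<le> z} \<Longrightarrow> l \<le> x"
      by (rule well_ordered_setD[OF well_ordered_hsupp sub ne]) blast
    have "\<forall>x\<in>Z. l \<le> x" using l by (metis (mono_tags, lifting) linear mem_Collect_eq order_trans)
    then show "\<exists>l\<in>Z. \<forall>x\<in>Z. l \<le> x" using l(1) by blast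
  qed
  define b where "b = Abs_hahn B"
  have cb: "hcoeff b = B" unfolding b_def using wB by (simp add: Abs_hahn_inverse)
  have "(1 - u) * b = 1"
  proof (rule hahn_eqI)
    fix e
    define k where "k = N e"
    define P where "P = (\<Sum>n\<le>k. u ^ n)"
    have "(1 - u) * P = 1 - u ^ Suc k"
      unfolding P_def by (metis lessThan_Suc_atMost one_diff_power_eq)
    then have "(1 - u) * b = 1 - u ^ Suc k + (1 - u) * (b - P)" by (simp add: algebra_simps)
    moreover have "hcoeff (u ^ Suc k) e = 0" by (rule van) (simp add: k_def)
    moreover have "hcoeff ((1 - u) * (b - P)) e = 0"
    proof (rule ccontr)
      assume "hcoeff ((1 - u) * (b - P)) e \<noteq> 0"
      then obtain x y where xy: "x \<in> hsupp (1 - u)" "y \<in> hsupp (b - P)" "e = x + y"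
        using hsupp_times[of "1 - u" "b - P"] by (auto simp: hsupp_def)
      have "x = 0 \<or> x \<in> hsupp u"
        using xy(1) by (auto simp: hsupp_def minus_hahn.rep_eq one_hahn_def hmonom.rep_eq split: if_splits)
      then have "0 \<le> x" using um m by fastforce
      then have "N y \<le> k" using xy(3) Nmono unfolding k_def by simp
      then have "hcoeff (b - P) y = 0" using Beq by (simp add: minus_hahn.rep_eq cb P_def)
      then show False using xy(2) by (simp add: hsupp_def)
    qed
    ultimately show "hcoeff ((1 - u) * b) e = hcoeff 1 e"
      by (simp add: plus_hahn.rep_eq minus_hahn.rep_eq)
  qed
  then show ?thesis by blast
qed

lemma hahn_ex_inverse:
  fixes a :: hahn
  assumes "a \<noteq> 0"
  shows "\<exists>b. a * b = 1"
proof -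
  have "hsupp a \<noteq> {}" using assms by (auto simp: hsupp_def zero_hahn.rep_eq intro: hahn_eqI)
  then obtain g where g: "g \<in> hsupp a" "\<And>e. e \<in> hsupp a \<Longrightarrow> g \<le> e"
    using well_ordered_setD[OF well_ordered_hsupp[of a] order_refl] by blast
  define c where "c = hcoeff a g"
  have c: "c \<noteq> 0" using g(1) by (simp add: c_def hsupp_def)
  define h where "h = hmonom (inverse c) (- g)"
  define u where "u = 1 - h * a"
  have ucoeff: "hcoeff u e = (if e = 0 then 0 else - inverse c * hcoeff a (e + g))" for e
    using c by (simp add: u_def h_def minus_hahn.rep_eq one_hahn_def hmonom.rep_eq hcoeff_hmonom_times)
      (simp add: c_def)
  have upos: "e > 0" if "e \<in> hsupp u" for e
  proof -
    have "e \<noteq> 0" "e + g \<in> hsupp a" using that unfolding hsupp_def ucoeff by (auto split: if_splits)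
    then show ?thesis using g(2) by force
  qed
  have "\<exists>m>0. \<forall>e\<in>hsupp u. m \<le> e"
  proof (cases "hsupp u = {}")
    case True
    then show ?thesis by (intro exI[of _ 1]) simp
  next
    case False
    then obtain m where "m \<in> hsupp u" "\<And>e. e \<in> hsupp u \<Longrightarrow> m \<le> e"
      using well_ordered_setD[OF well_ordered_hsupp[of u] order_refl] by blast
    then show ?thesis using upos by blast
  qed
  then obtain b where "(1 - u) * b = 1" using ex_inverse_one_minus[of _ u] by blast
  then have "a * (h * b) = 1" by (simp add: u_def mult.commute mult.left_commute)
  then show ?thesis by blast
qed

instantiation hahn :: field
begin

definition inverse_hahn :: "hahn \<Rightarrow> hahn" where
  "inverse a = (if a = 0 then 0 else (SOME b. a * b = 1))" for a :: hahn

definition divide_hahn :: "hahn \<Rightarrow> hahn \<Rightarrow> hahn" where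
  "a div b = a * inverse b" for a b :: hahn

instance
proof
  fix a b :: hahn
  show "inverse a * a = 1" if "a \<noteq> 0"
    using someI_ex[OF hahn_ex_inverse[OF that]] that by (simp add: inverse_hahn_def mult.commute)
qed (auto simp: divide_hahn_def inverse_hahn_def)

end

definition hdeg :: "hahn \<Rightarrow> ereal" where
  "hdeg a = (if a = 0 then \<infinity> else ereal (LEAST e. e \<in> hsupp a))"

lemma hdeg_hmonom: "c \<noteq> 0 \<Longrightarrow> hdeg (hmonom c g) = ereal g"
proof -
  assume c: "c \<noteq> 0"
  then have s: "hsupp (hmonom c g) = {g}" by (auto simp: hsupp_def hmonom.rep_eq)
  then have "hmonom c g \<noteq> 0" by (auto simp: hsupp_def zero_hahn.rep_eq)
  then show ?thesis by (simp add: hdeg_def s) (rule Least_equality, auto)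
qed

definition perm_weight :: "real mat \<Rightarrow> (nat \<Rightarrow> nat) \<Rightarrow> real" where
  "perm_weight S \<sigma> = (\<Sum>i<dim_row S. S $$ (i, \<sigma> i))"

definition tropically_nonsingular :: "real mat \<Rightarrow> bool" where
  "tropically_nonsingular S \<longleftrightarrow>
     (\<exists>!\<sigma>. is_arg_min (perm_weight S) (\<lambda>\<tau>. \<tau> permutes {..<dim_row S}) \<sigma>)"

text \<open>The empty submatrix counts as tropically nonsingular, so every matrix has a tropical rank.\<close>

definition tropical_rank :: "real mat \<Rightarrow> nat" where
  "tropical_rank A = Max {r. \<exists>I J. I \<subseteq> {..<dim_row A} \<and> J \<subseteq> {..<dim_col A} \<and>
      card I = r \<and> card J = r \<and> tropically_nonsingular (submatrix A I J)}"

definition kapranov_rank :: "real mat \<Rightarrow> nat" where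
  "kapranov_rank B = (LEAST r. \<exists>A :: hahn mat.
      A \<in> carrier_mat (dim_row B) (dim_col B) \<and>
      (\<forall>i<dim_row B. \<forall>j<dim_col B. hdeg (A $$ (i, j)) = ereal (B $$ (i, j))) \<and>
      vec_space.rank (dim_row B) A = r)"

text \<open>\<open>tropical_rank\<close> and \<open>kapranov_rank\<close> are the maximum of a finite nonempty set and the
  least element of a nonempty one.\<close>

lemma tropical_rank_set:
  fixes A :: "real mat"
  defines "R \<equiv> {r. \<exists>I J. I \<subseteq> {..<dim_row A} \<and> J \<subseteq> {..<dim_col A} \<and>
      card I = r \<and> card J = r \<and> tropically_nonsingular (submatrix A I J)}"
  shows "finite R" "R \<noteq> {}"
proof -
  have "R \<subseteq> {..dim_row A}"
    unfolding R_def using card_mono[of "{..<dim_row A}"] by fastforce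
  then show "finite R" by (rule finite_subset) simp
  have "tropically_nonsingular (submatrix A {} {})"
    by (auto simp: tropically_nonsingular_def is_arg_min_def dim_submatrix)
  then have "0 \<in> R" unfolding R_def by (intro CollectI exI[of _ "{}"]) simp
  then show "R \<noteq> {}" by blast
qed

lemma kapranov_rank_attained:
  "\<exists>A :: hahn mat. A \<in> carrier_mat (dim_row B) (dim_col B) \<and>
      (\<forall>i<dim_row B. \<forall>j<dim_col B. hdeg (A $$ (i, j)) = ereal (B $$ (i, j))) \<and>
      vec_space.rank (dim_row B) A = kapranov_rank B"
  unfolding kapranov_rank_def
proof (rule LeastI_ex)
  let ?A = "mat (dim_row B) (dim_col B) (\<lambda>ij. hmonom 1 (B $$ ij))"
  show "\<exists>r. \<exists>A :: hahn mat. A \<in> carrier_mat (dim_row B) (dim_col B) \<and>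
      (\<forall>i<dim_row B. \<forall>j<dim_col B. hdeg (A $$ (i, j)) = ereal (B $$ (i, j))) \<and>
      vec_space.rank (dim_row B) A = r"
    by (intro exI[of _ ?A] exI conjI) (auto simp: hdeg_hmonom)
qed

end

theory Submission
  imports Defs
begin

text \<open>Take A' and A'' to be A with its last row, respectively its last column, repeated. Reindexing
  rows and columns does not increase either rank: a lift of A is reindexed to a lift of the new
  matrix, and a tropically nonsingular submatrix cannot use two equal rows or columns, as swapping
  them would give a second optimal permutation. Conversely, A is itself a reindexing of A' and A''.\<close>

section \<open>Matrix rank and Kapranov rank under reindexing\<close>

text \<open>A maximal independent set of columns has rank many elements. It is recorded by column
  indices rather than by vectors, so that the choice can be carried to another matrix.\<close>

lemma (in vec_space) rank_attained_by_columns: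
  assumes "B \<in> carrier_mat n nc"
  obtains js where "length js = rank B" "set js \<subseteq> {..<nc}"
    "distinct (map (col B) js)" "lin_indpt (set (map (col B) js))"
proof -
  obtain S where S: "maximal S (\<lambda>T. T \<subseteq> set (cols B) \<and> lin_indpt T)" "finite S"
    using maximal_exists_superset[of "set (cols B)" "\<lambda>T. T \<subseteq> set (cols B) \<and> lin_indpt T" "{}"]
    by (auto simp: lin_dep_def)
  then have S': "S \<subseteq> set (cols B)" "lin_indpt S" by (simp_all add: maximal_def)
  obtain xs where xs: "set xs = S" "distinct xs" using finite_distinct_list[OF S(2)] by blast
  have "\<forall>v\<in>S. \<exists>j<nc. col B j = v" using S'(1) assms by (fastforce simp: cols_def)
  then obtain h where h: "\<And>v. v \<in> S \<Longrightarrow> h v < nc \<and> col B (h v) = v" by metis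
  have eq: "map (col B) (map h xs) = xs" using h xs(1) by (intro nth_equalityI) auto
  have "length xs = rank B" using rank_card_indpt[OF assms S(1)] xs distinct_card by fastforce
  then show ?thesis using that[of "map h xs"] eq xs S'(2) h by auto
qed

text \<open>Reading off the coordinates \<open>f i\<close> is a linear map that sends column
  \<open>g j\<close> of \<open>A\<close> to column \<open>j\<close> of the reindexed matrix.
  Preimages of independent vectors under a linear map are independent, so \<open>f\<close> and
  \<open>g\<close> may repeat or omit indices.\<close>

lemma rank_reindex_le:
  fixes A :: "'a :: field mat"
  assumes A: "A \<in> carrier_mat d n"
    and f: "\<And>i. i < d' \<Longrightarrow> f i < d" and g: "\<And>j. j < n' \<Longrightarrow> g j < n"
  shows "vec_space.rank d' (mat d' n' (\<lambda>(i, j). A $$ (f i, g j))) \<le> vec_space.rank d A"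
proof -
  define B where "B = mat d' n' (\<lambda>(i, j). A $$ (f i, g j))"
  have B: "B \<in> carrier_mat d' n'" by (simp add: B_def)
  obtain js where js: "length js = vec_space.rank d' B" "set js \<subseteq> {..<n'}"
    "distinct (map (col B) js)"
    "module.lin_indpt class_ring (module_vec TYPE('a) d') (set (map (col B) js))"
    by (rule vec_space.rank_attained_by_columns[OF B])
  define k where "k = length js"
  have js_lt: "js ! l < n'" if "l < k" for l
  proof -
    have "js ! l \<in> set js" using that unfolding k_def by (rule nth_mem)
    then show ?thesis using js(2) by blast
  qed
  \<comment> \<open>\<open>N\<close> holds independent columns realizing the rank of
    \<open>B\<close>, and \<open>M\<close> holds the columns of \<open>A\<close> that they come
    from.\<close>
  define M where "M = mat_of_cols d (map (\<lambda>j. col A (g j)) js)"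
  define N where "N = mat_of_cols d' (map (col B) js)"
  have M: "M \<in> carrier_mat d k" and N: "N \<in> carrier_mat d' k" by (auto simp: M_def N_def k_def)
  have cM: "cols M = map (\<lambda>j. col A (g j)) js"
    unfolding M_def by (rule cols_mat_of_cols) (use A col_dim[of A] in auto)
  have cN: "cols N = map (col B) js"
    unfolding N_def by (rule cols_mat_of_cols) (use B col_dim[of B] in auto)
  have entry: "N $$ (i, l) = M $$ (f i, l)" if "i < d'" "l < k" for i l
    using that A f g js_lt by (simp add: M_def N_def mat_of_cols_index B_def k_def)
  have colB: "col B j = vec d' (\<lambda>i. col A (g j) $ f i)" if "j < n'" for j
  proof (rule eq_vecI)
    show "dim_vec (col B j) = dim_vec (vec d' (\<lambda>i. col A (g j) $ f i))" using B by simp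
    fix i assume "i < dim_vec (vec d' (\<lambda>i. col A (g j) $ f i))"
    then have i: "i < d'" by simp
    have "col B j $ i = A $$ (f i, g j)" using i that by (simp add: B_def)
    then show "col B j $ i = vec d' (\<lambda>i. col A (g j) $ f i) $ i"
      using A i f[OF i] g[OF that] by simp
  qed
  \<comment> \<open>The columns of \<open>N\<close> are the images of those of \<open>M\<close>
    under one map, so distinct images force distinct arguments.\<close>
  have dist: "distinct (cols M)"
  proof -
    have "map (col B) js = map (\<lambda>v. vec d' (\<lambda>i. v $ f i)) (cols M)"
      unfolding cM map_map by (rule map_cong) (use js(2) colB in auto)
    with js(3) have "distinct (map (\<lambda>v. vec d' (\<lambda>i. v $ f i)) (cols M))" by (simp only:)
    then show ?thesis by (simp only: distinct_map)
  qed
  have indpt: "module.lin_indpt class_ring (module_vec TYPE('a) d) (set (cols M))"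
  proof
    assume "module.lin_dep class_ring (module_vec TYPE('a) d) (set (cols M))"
    then obtain v where v: "v \<in> carrier_vec k" "v \<noteq> 0\<^sub>v k" "M *\<^sub>v v = 0\<^sub>v d"
      using vec_space.lin_depE[OF M _ dist] by blast
    \<comment> \<open>Row \<open>i\<close> of \<open>N\<close> is row \<open>f i\<close> of
      \<open>M\<close>, so a kernel vector of \<open>M\<close> is one of \<open>N\<close>.\<close>
    have "N *\<^sub>v v = 0\<^sub>v d'"
    proof (rule eq_vecI)
      fix i assume "i < dim_vec (0\<^sub>v d' :: 'a vec)"
      then have i: "i < d'" by simp
      have "(N *\<^sub>v v) $ i = (M *\<^sub>v v) $ f i"
        using i M N f v(1) by (auto simp: scalar_prod_def entry intro!: sum.cong)
      then show "(N *\<^sub>v v) $ i = 0\<^sub>v d' $ i" using v(3) i f by simp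
    qed (use N in simp)
    then have "module.lin_dep class_ring (module_vec TYPE('a) d') (set (cols N))"
      using vec_space.lin_depI[OF N v(1,2)] js(3) cN by simp
    then show False using js(4) cN by simp
  qed
  have "set (cols M) \<subseteq> set (cols A)"
    unfolding cM set_map using js(2) g A by (auto simp: cols_def)
  then have "card (set (cols M)) \<le> vec_space.rank d A"
    by (rule vec_space.rank_ge_card_indpt[OF A _ indpt])
  moreover have "card (set (cols M)) = k" using distinct_card[OF dist] M by simp
  ultimately show ?thesis using js(1) by (simp add: k_def B_def)
qed

text \<open>Start from a lift of \<open>A\<close> of minimal rank: its reindexing has the required
  degrees entry by entry and no larger rank.\<close>

lemma kapranov_rank_reindex_le:
  fixes A :: "real mat"
  assumes A: "A \<in> carrier_mat d n"
    and f: "\<And>i. i < d' \<Longrightarrow> f i < d" and g: "\<And>j. j < n' \<Longrightarrow> g j < n"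
  shows "kapranov_rank (mat d' n' (\<lambda>(i, j). A $$ (f i, g j))) \<le> kapranov_rank A"
proof -
  obtain L :: "hahn mat" where L: "L \<in> carrier_mat d n"
    "\<And>i j. i < d \<Longrightarrow> j < n \<Longrightarrow> hdeg (L $$ (i, j)) = ereal (A $$ (i, j))"
    "vec_space.rank d L = kapranov_rank A"
    using kapranov_rank_attained[of A] A by auto
  have "kapranov_rank (mat d' n' (\<lambda>(i, j). A $$ (f i, g j)))
      \<le> vec_space.rank d' (mat d' n' (\<lambda>(i, j). L $$ (f i, g j)))"
    unfolding kapranov_rank_def
    by (intro Least_le exI[of _ "mat d' n' (\<lambda>(i, j). L $$ (f i, g j))"]) (simp add: L(2) f g)
  also have "\<dots> \<le> kapranov_rank A"
    unfolding L(3)[symmetric] using L(1) f g by (rule rank_reindex_le)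
  finally show ?thesis .
qed

section \<open>Tropical rank under reindexing\<close>

text \<open>The element \<open>pick I i\<close> is the one with exactly \<open>i\<close> smaller
  elements in \<open>I\<close>, and a strictly increasing map preserves this count.\<close>

lemma strict_mono_on_pick:
  assumes "finite I" "strict_mono_on I f" "i < card I"
  shows "pick (f ` I) i = f (pick I i)"
proof -
  have p: "pick I i \<in> I" using pick_in_set_le assms(3) by blast
  have "{b \<in> f ` I. b < f (pick I i)} = f ` {a \<in> I. a < pick I i}"
    using p strict_mono_on_less[OF assms(2)] by auto
  moreover have "inj_on f {a \<in> I. a < pick I i}"
    using strict_mono_on_imp_inj_on[OF assms(2)] by (rule inj_on_subset) auto
  ultimately have "card {b \<in> f ` I. b < f (pick I i)} = i"
    using card_image card_pick_le[OF assms(3)] by metis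
  then show ?thesis using pick_card_in_set[of "f (pick I i)" "f ` I"] p by auto
qed

lemma perm_weight_permute_cong:
  assumes "\<pi> permutes {..<dim_row S}"
    and "\<And>i. i < dim_row S \<Longrightarrow> S $$ (i, \<sigma> i) = S $$ (\<pi> i, \<tau> (\<pi> i))"
  shows "perm_weight S \<sigma> = perm_weight S \<tau>"
  unfolding perm_weight_def
  using sum.permute[OF assms(1), of "\<lambda>i. S $$ (i, \<tau> i)"] assms(2) by simp

text \<open>Precomposing an optimal permutation with the swap of the two rows keeps its weight, so
  uniqueness would give both rows the same column.\<close>

lemma not_tropically_nonsingular_eq_rows:
  assumes a: "a < dim_row S" "b < dim_row S" "a \<noteq> b"
    and eq: "\<And>j. j < dim_row S \<Longrightarrow> S $$ (a, j) = S $$ (b, j)"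
  shows "\<not> tropically_nonsingular S"
proof
  let ?P = "\<lambda>\<tau>. \<tau> permutes {..<dim_row S}"
  assume "tropically_nonsingular S"
  then obtain \<sigma> where \<sigma>: "is_arg_min (perm_weight S) ?P \<sigma>"
    "\<And>\<tau>. is_arg_min (perm_weight S) ?P \<tau> \<Longrightarrow> \<tau> = \<sigma>"
    unfolding tropically_nonsingular_def by blast
  have P: "?P \<sigma>" using \<sigma>(1) by (simp add: is_arg_min_def)
  have T: "?P (transpose a b)" using a by (intro permutes_swap_id) auto
  have P': "?P (\<sigma> \<circ> transpose a b)" using permutes_compose[OF T P] .
  have lt: "\<sigma> i < dim_row S" if "i < dim_row S" for i
    using permutes_in_image[OF P, of i] that by simp
  \<comment> \<open>The swap exchanges two summands, hence the sum is reordered by the swap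
    itself.\<close>
  have "perm_weight S (\<sigma> \<circ> transpose a b) = perm_weight S \<sigma>"
    using T by (rule perm_weight_permute_cong) (use eq lt a in \<open>auto simp: transpose_def\<close>)
  then have "is_arg_min (perm_weight S) ?P (\<sigma> \<circ> transpose a b)"
    using \<sigma>(1) P' by (simp add: is_arg_min_def)
  then have "\<sigma> \<circ> transpose a b = \<sigma>" by (rule \<sigma>(2))
  then have "\<sigma> b = \<sigma> a" by (metis comp_apply transpose_apply_first)
  then show False using permutes_inj[OF P] a(3) by (simp add: inj_eq)
qed

text \<open>Here the swap is applied after the permutation, and the weights agree summand by
  summand. Columns are bounded by \<open>dim_row S\<close> because the permutations act on that
  range.\<close>

lemma not_tropically_nonsingular_eq_cols:
  assumes a: "a < dim_row S" "b < dim_row S" "a \<noteq> b"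
    and eq: "\<And>i. i < dim_row S \<Longrightarrow> S $$ (i, a) = S $$ (i, b)"
  shows "\<not> tropically_nonsingular S"
proof
  let ?P = "\<lambda>\<tau>. \<tau> permutes {..<dim_row S}"
  assume "tropically_nonsingular S"
  then obtain \<sigma> where \<sigma>: "is_arg_min (perm_weight S) ?P \<sigma>"
    "\<And>\<tau>. is_arg_min (perm_weight S) ?P \<tau> \<Longrightarrow> \<tau> = \<sigma>"
    unfolding tropically_nonsingular_def by blast
  have P: "?P \<sigma>" using \<sigma>(1) by (simp add: is_arg_min_def)
  have T: "?P (transpose a b)" using a by (intro permutes_swap_id) auto
  have P': "?P (transpose a b \<circ> \<sigma>)" using permutes_compose[OF P T] .
  have "perm_weight S (transpose a b \<circ> \<sigma>) = perm_weight S \<sigma>"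
    unfolding perm_weight_def
    by (rule sum.cong[OF refl]) (use eq in \<open>auto simp: transpose_def\<close>)
  then have "is_arg_min (perm_weight S) ?P (transpose a b \<circ> \<sigma>)"
    using \<sigma>(1) P' by (simp add: is_arg_min_def)
  then have eq': "transpose a b \<circ> \<sigma> = \<sigma>" by (rule \<sigma>(2))
  obtain c where "\<sigma> c = a" using permutes_surj[OF P] by (metis surjD)
  then show False using fun_cong[OF eq', of c] a(3) by simp
qed

text \<open>A collision of \<open>f\<close> on \<open>I\<close> or of \<open>g\<close> on
  \<open>J\<close> would produce two equal rows or columns. Without collisions the monotone maps are
  strictly increasing, so they keep the order in which \<open>submatrix\<close> lists its indices,
  and the same submatrix occurs in \<open>A\<close>.\<close>

lemma tropically_nonsingular_reindex:
  fixes A :: "real mat" and d' n' :: nat and f g :: "nat \<Rightarrow> nat"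
  defines "B \<equiv> mat d' n' (\<lambda>(i, j). A $$ (f i, g j))"
  assumes A: "A \<in> carrier_mat d n"
    and f: "\<And>i. i < d' \<Longrightarrow> f i < d" "mono_on {..<d'} f"
    and g: "\<And>j. j < n' \<Longrightarrow> g j < n" "mono_on {..<n'} g"
    and IJ: "I \<subseteq> {..<d'}" "J \<subseteq> {..<n'}" "card I = card J"
    and ns: "tropically_nonsingular (submatrix B I J)"
  shows "inj_on f I" "inj_on g J"
    "submatrix A (f ` I) (g ` J) = submatrix B I J"
proof -
  let ?S = "submatrix B I J"
  have fin: "finite I" "finite J" using IJ(1,2) finite_subset by blast+
  have cI: "{i. i < d' \<and> i \<in> I} = I" and cJ: "{j. j < n' \<and> j \<in> J} = J" using IJ by auto
  have dim: "dim_row ?S = card I" "dim_col ?S = card J"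
    by (simp_all add: dim_submatrix B_def cI cJ)
  have pI: "pick I i \<in> I" "pick I i < d'" if "i < card I" for i
    using pick_in_set_le[OF that] IJ(1) by auto
  have pJ: "pick J j \<in> J" "pick J j < n'" if "j < card J" for j
    using pick_in_set_le[OF that] IJ(2) by auto
  have entry: "?S $$ (i, j) = A $$ (f (pick I i), g (pick J j))" if "i < card I" "j < card J" for i j
    using that pI pJ by (simp add: submatrix_def B_def cI cJ)
  \<comment> \<open>Each element of \<open>K\<close> is picked at the position given by the number
    of smaller elements, which locates colliding indices inside the submatrix.\<close>
  have pos: "\<exists>i<card K. pick K i = x" if "x \<in> K" "finite K" for x and K :: "nat set"
    using that by (intro exI[of _ "card {a \<in> K. a < x}"] conjI psubset_card_mono)
      (auto simp: pick_card_in_set)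
  show injf: "inj_on f I"
  proof (rule inj_onI, rule ccontr)
    fix x y assume xy: "x \<in> I" "y \<in> I" "f x = f y" "x \<noteq> y"
    obtain a b where "a < card I" "pick I a = x" "b < card I" "pick I b = y"
      using pos[OF xy(1) fin(1)] pos[OF xy(2) fin(1)] by blast
    then have "\<not> tropically_nonsingular ?S"
      using xy IJ(3) by (intro not_tropically_nonsingular_eq_rows[of a _ b]) (auto simp: dim entry)
    then show False using ns by blast
  qed
  show injg: "inj_on g J"
  proof (rule inj_onI, rule ccontr)
    fix x y assume xy: "x \<in> J" "y \<in> J" "g x = g y" "x \<noteq> y"
    obtain a b where "a < card J" "pick J a = x" "b < card J" "pick J b = y"
      using pos[OF xy(1) fin(2)] pos[OF xy(2) fin(2)] by blast
    then have "\<not> tropically_nonsingular ?S"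
      using xy IJ(3) by (intro not_tropically_nonsingular_eq_cols[of a _ b]) (auto simp: dim entry)
    then show False using ns by blast
  qed
  have sf: "strict_mono_on I f"
    using f(2) injf IJ(1)
    by (fastforce intro!: strict_mono_onI simp: less_le inj_on_eq_iff dest: mono_onD)
  have sg: "strict_mono_on J g"
    using g(2) injg IJ(2)
    by (fastforce intro!: strict_mono_onI simp: less_le inj_on_eq_iff dest: mono_onD)
  have cfI: "{i. i < d \<and> i \<in> f ` I} = f ` I" and cgJ: "{j. j < n \<and> j \<in> g ` J} = g ` J"
    using f(1) g(1) IJ(1,2) by auto
  let ?T = "submatrix A (f ` I) (g ` J)"
  have dimT: "dim_row ?T = card I" "dim_col ?T = card J"
    using A by (simp_all add: dim_submatrix cfI cgJ card_image injf injg)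
  show "?T = ?S"
  proof (rule eq_matI)
    fix i j assume "i < dim_row ?S" "j < dim_col ?S"
    then have ij: "i < card I" "j < card J" by (simp_all only: dim)
    then have "?T $$ (i, j) = A $$ (pick (f ` I) i, pick (g ` J) j)"
      using A by (intro submatrix_index) (simp_all add: cfI cgJ card_image injf injg)
    then show "?T $$ (i, j) = ?S $$ (i, j)"
      using ij by (simp add: entry strict_mono_on_pick fin sf sg)
  qed (simp_all only: dim dimT)
qed

text \<open>A nonsingular submatrix of maximal size reappears in \<open>A\<close> on the image index
  sets, whose cardinalities are unchanged by injectivity.\<close>

lemma tropical_rank_reindex_le:
  fixes A :: "real mat"
  assumes A: "A \<in> carrier_mat d n"
    and f: "\<And>i. i < d' \<Longrightarrow> f i < d" "mono_on {..<d'} f"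
    and g: "\<And>j. j < n' \<Longrightarrow> g j < n" "mono_on {..<n'} g"
  shows "tropical_rank (mat d' n' (\<lambda>(i, j). A $$ (f i, g j))) \<le> tropical_rank A"
proof -
  let ?B = "mat d' n' (\<lambda>(i, j). A $$ (f i, g j))"
  have "tropical_rank ?B \<in> {r. \<exists>I J. I \<subseteq> {..<dim_row ?B} \<and> J \<subseteq> {..<dim_col ?B} \<and>
      card I = r \<and> card J = r \<and> tropically_nonsingular (submatrix ?B I J)}"
    unfolding tropical_rank_def by (rule Max_in) (rule tropical_rank_set)+
  then obtain I J where IJ: "I \<subseteq> {..<d'}" "J \<subseteq> {..<n'}" "card I = tropical_rank ?B"
    "card J = tropical_rank ?B" "tropically_nonsingular (submatrix ?B I J)"
    by auto
  note R = tropically_nonsingular_reindex[OF A f g IJ(1,2) _ IJ(5)]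
  have "tropical_rank ?B \<in> {r. \<exists>I J. I \<subseteq> {..<dim_row A} \<and> J \<subseteq> {..<dim_col A} \<and>
      card I = r \<and> card J = r \<and> tropically_nonsingular (submatrix A I J)}"
    using A f(1) g(1) IJ R
    by (intro CollectI exI[of _ "f ` I"] exI[of _ "g ` J"]) (auto simp: card_image)
  then show ?thesis
    unfolding tropical_rank_def[of A] by (intro Max_ge tropical_rank_set(1))
qed

section \<open>Repeating the last row or column\<close>

text \<open>The map \<open>min i (d - 1)\<close> fixes every index below \<open>d\<close> and sends
  all others to the last one, so \<open>B d' n'\<close> repeats the last row and column. It is
  monotone and a left inverse of the inclusion of indices; reindexing along both maps bounds each
  rank in both directions.\<close>

lemma reindex_retract_ranks:
  fixes A :: "real mat" and d n :: nat
  defines "B d' n' \<equiv> mat d' n' (\<lambda>(i, j). A $$ (min i (d - 1), min j (n - 1)))"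
  assumes A: "A \<in> carrier_mat d n" and pos: "0 < d" "0 < n" and le: "d \<le> d'" "n \<le> n'"
  shows "tropical_rank (B d' n') = tropical_rank A" "kapranov_rank (B d' n') = kapranov_rank A"
proof -
  have B: "B d' n' \<in> carrier_mat d' n'" by (simp add: B_def)
  \<comment> \<open>\<open>A\<close> is the upper left block of \<open>B d' n'\<close>, that is, its
    reindexing by identity maps.\<close>
  have A_eq: "A = mat d n (\<lambda>(i, j). B d' n' $$ (i, j))"
  proof (rule eq_matI)
    fix i j assume "i < dim_row (mat d n (\<lambda>(i, j). B d' n' $$ (i, j)))"
      "j < dim_col (mat d n (\<lambda>(i, j). B d' n' $$ (i, j)))"
    then have ij: "i < d" "j < n" by simp_all
    then have "i < d'" "j < n'" "min i (d - 1) = i" "min j (n - 1) = j" using le by linarith+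
    then show "A $$ (i, j) = mat d n (\<lambda>(i, j). B d' n' $$ (i, j)) $$ (i, j)"
      using ij by (simp add: B_def)
  qed (use A in simp_all)
  have mono: "mono_on S (\<lambda>i::nat. min i m)" "mono_on S (\<lambda>i::nat. i)" for S m
    by (intro mono_onI; simp add: min.coboundedI1)+
  have "tropical_rank A \<le> tropical_rank (B d' n')"
    by (subst A_eq, rule tropical_rank_reindex_le[OF B]) (use le mono in auto)
  moreover have "tropical_rank (B d' n') \<le> tropical_rank A"
    unfolding B_def by (rule tropical_rank_reindex_le[OF A]) (use pos mono in auto)
  ultimately show "tropical_rank (B d' n') = tropical_rank A" by simp
  have "kapranov_rank A \<le> kapranov_rank (B d' n')"
    by (subst A_eq, rule kapranov_rank_reindex_le[OF B]) (use le in auto)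
  moreover have "kapranov_rank (B d' n') \<le> kapranov_rank A"
    unfolding B_def by (rule kapranov_rank_reindex_le[OF A]) (use pos in auto)
  ultimately show "kapranov_rank (B d' n') = kapranov_rank A" by simp
qed

text \<open>This guarantees a last row and a last column to repeat: a lift without rows or without
  columns has rank 0.\<close>

lemma kapranov_rank_pos_imp_dims_pos:
  assumes A: "A \<in> carrier_mat d n" and "kapranov_rank A > 0"
  shows "0 < d" "0 < n"
proof -
  obtain L :: "hahn mat" where L: "L \<in> carrier_mat d n" "vec_space.rank d L = kapranov_rank A"
    using kapranov_rank_attained[of A] A by auto
  show "0 < n" using vec_space.rank_le_nc[OF L(1)] L(2) assms(2) by simp
  show "0 < d"
  proof (rule ccontr)
    assume "\<not> 0 < d"
    then have "L = 0\<^sub>m d n" using L(1) by (intro eq_matI) auto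
    then show False using vec_space.rank_0I[of d n, where 'a = hahn] L(2) assms(2) by simp
  qed
qed

theorem theorem4p2:
  fixes A :: "real mat" and d n r :: nat
  assumes "A \<in> carrier_mat d n"
    and "tropical_rank A = r"
    and "kapranov_rank A > r"
  shows "\<exists>A' A''. A' \<in> carrier_mat (d + 1) n \<and> A'' \<in> carrier_mat d (n + 1) \<and>
      tropical_rank A' = r \<and> tropical_rank A'' = r \<and>
      kapranov_rank A' = kapranov_rank A'' \<and> kapranov_rank A'' > r"
proof -
  have pos: "0 < d" "0 < n"
    using kapranov_rank_pos_imp_dims_pos[OF assms(1)] assms(3) by simp_all
  define B where "B d' n' = mat d' n' (\<lambda>(i, j). A $$ (min i (d - 1), min j (n - 1)))" for d' n'
  note R = reindex_retract_ranks[OF assms(1) pos, folded B_def]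
  show ?thesis
    \<comment> \<open>Enlarging only one dimension repeats only the last row or only the last
      column, since \<open>min\<close> is the identity on the other index range.\<close>
    by (intro exI[of _ "B (d + 1) n"] exI[of _ "B d (n + 1)"]) (use assms R in \<open>simp add: B_def\<close>)
qed

end
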